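(* Let $d,m,T\ge1$ be integers, $U=(u_1,\dots,u_m)\in(\mathbb{S}^{d-1})^m$ and $\Gamma=[\gamma_{t,j}]\in\mathbb{R}^{T\times m}$, where $\Gamma$ is treated as a free coefficient matrix. A necessary condition for the restricted differential $J_{\mathrm{res}}(U,\Gamma)$ to be injective is $$m(d-1)+Tm\le T\,\frac{d(d+1)}{2}.$$ When $\frac{d(d+1)}{2}>m$, this condition is equivalent to $$T\ge\frac{m(d-1)}{\frac{d(d+1)}{2}-m}.$$ This condition is necessary but not sufficient: in general it does not imply that $J_{\mathrm{res}}(U,\Gamma)$ is injective.
   Context: $\mathbb{S}^{d-1}=\{u\in\mathbb{R}^d:\|u\|_2=1\}$. For $U\in(\mathbb{S}^{d-1})^m$ and $\Gamma\in\mathbb{R}^{T\times m}$ let $\Psi(U,\Gamma)=\big(\sum_{j=1}^m\gamma_{t,j}u_ju_j^\top\big)_{t=1}^T$, a $T$-tuple of symmetric $d\times d$ real matrices. $J_{\mathrm{res}}(U,\Gamma)$ is the differential of $\Psi$ at $(U,\Gamma)$ restricted to tangent perturbations: the linear map sending $(\dot U,\dot\Gamma)$, where $\dot U=(\dot u_1,\dots,\dot u_m)$ with $u_j^\top\dot u_j=0$ for all $j$ and $\dot\Gamma\in\mathbb{R}^{T\times m}$ is arbitrary, to the $T$-tuple with $t$-th entry $\sum_{j=1}^m[\dot\gamma_{t,j}u_ju_j^\top+\gamma_{t,j}(\dot u_ju_j^\top+u_j\dot u_j^\top)]$. *)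

theory Defs
  imports "HOL-Analysis.L2_Norm" "Jordan_Normal_Form.Matrix"
begin

text \<open>
  Vectors and matrices are those of \<open>Jordan_Normal_Form\<close>, so that the dimensions are natural numbers
  that can be quantified over. Indices start at \<open>0\<close>. A \<open>k\<close>-tuple is a function in an
  extensional product over \<open>{..<k}\<close>, so equality of functions is equality of tuples.
\<close>

definition unit_sphere :: "nat \<Rightarrow> real vec set" where
  "unit_sphere d = {u \<in> carrier_vec d. L2_set (\<lambda>i. u $ i) {..<d} = 1}"

definition outer :: "real vec \<Rightarrow> real vec \<Rightarrow> real mat" where
  "outer u v = mat (dim_vec u) (dim_vec v) (\<lambda>(a, b). u $ a * v $ b)"

definition matsum :: "nat \<Rightarrow> nat \<Rightarrow> (nat \<Rightarrow> real mat) \<Rightarrow> real mat" where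
  "matsum d m A = mat d d (\<lambda>(a, b). \<Sum>j<m. A j $$ (a, b))"

definition Psi :: "nat \<Rightarrow> nat \<Rightarrow> nat \<Rightarrow> (nat \<Rightarrow> real vec) \<Rightarrow> real mat \<Rightarrow> nat \<Rightarrow> real mat" where
  "Psi d m T U \<Gamma> = (\<lambda>t\<in>{..<T}. matsum d m (\<lambda>j. \<Gamma> $$ (t, j) \<cdot>\<^sub>m outer (U j) (U j)))"

definition tangent_perturbations ::
    "nat \<Rightarrow> nat \<Rightarrow> nat \<Rightarrow> (nat \<Rightarrow> real vec) \<Rightarrow> ((nat \<Rightarrow> real vec) \<times> real mat) set" where
  "tangent_perturbations d m T U =
     (\<Pi>\<^sub>E j\<in>{..<m}. {v \<in> carrier_vec d. U j \<bullet> v = 0}) \<times> carrier_mat T m"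

definition J_res :: "nat \<Rightarrow> nat \<Rightarrow> nat \<Rightarrow> (nat \<Rightarrow> real vec) \<Rightarrow> real mat \<Rightarrow>
    (nat \<Rightarrow> real vec) \<times> real mat \<Rightarrow> nat \<Rightarrow> real mat" where
  "J_res d m T U \<Gamma> = (\<lambda>(U', \<Gamma>'). \<lambda>t\<in>{..<T}. matsum d m (\<lambda>j.
     \<Gamma>' $$ (t, j) \<cdot>\<^sub>m outer (U j) (U j)
     + \<Gamma> $$ (t, j) \<cdot>\<^sub>m (outer (U' j) (U j) + outer (U j) (U' j))))"

text \<open>
  \<^const>\<open>J_res\<close> is the differential of \<^const>\<open>Psi\<close>: along every curve with velocity
  \<open>(U', \<Gamma>')\<close>, the entries of \<^const>\<open>Psi\<close> have the entries of \<^const>\<open>J_res\<close> as derivatives.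
\<close>

lemma Psi_has_derivative_J_res:
  fixes c :: "real \<Rightarrow> nat \<Rightarrow> real vec" and g :: "real \<Rightarrow> real mat"
  assumes c: "\<And>s j. j < m \<Longrightarrow> c s j \<in> carrier_vec d"
    and g: "\<And>s. g s \<in> carrier_mat T m"
    and U': "\<And>j. j < m \<Longrightarrow> U' j \<in> carrier_vec d"
    and \<Gamma>': "\<Gamma>' \<in> carrier_mat T m"
    and dc: "\<And>j i. j < m \<Longrightarrow> i < d \<Longrightarrow> ((\<lambda>s. c s j $ i) has_real_derivative U' j $ i) (at s0)"
    and dg: "\<And>t j. t < T \<Longrightarrow> j < m \<Longrightarrow>
      ((\<lambda>s. g s $$ (t, j)) has_real_derivative \<Gamma>' $$ (t, j)) (at s0)"
    and t: "t < T" and a: "a < d" and b: "b < d"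
  shows "((\<lambda>s. Psi d m T (c s) (g s) t $$ (a, b)) has_real_derivative
    J_res d m T (c s0) (g s0) (U', \<Gamma>') t $$ (a, b)) (at s0)"
proof -
  have dims: "dim_vec (c s j) = d" "dim_vec (U' j) = d" if "j < m" for s j
    using c[OF that] U'[OF that] by auto
  have P: "Psi d m T (c s) (g s) t $$ (a, b)
      = (\<Sum>j<m. g s $$ (t, j) * (c s j $ a * c s j $ b))" for s
    using t a b dims by (simp add: Psi_def matsum_def outer_def)
  have J: "J_res d m T (c s0) (g s0) (U', \<Gamma>') t $$ (a, b)
      = (\<Sum>j<m. \<Gamma>' $$ (t, j) * (c s0 j $ a * c s0 j $ b)
          + g s0 $$ (t, j) * (U' j $ a * c s0 j $ b + c s0 j $ a * U' j $ b))"
    using t a b dims by (simp add: J_res_def matsum_def outer_def)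
  show ?thesis
    unfolding P J
  proof (rule DERIV_sum)
    fix j assume "j \<in> {..<m}"
    then have j: "j < m" by simp
    show "((\<lambda>s. g s $$ (t, j) * (c s j $ a * c s j $ b)) has_real_derivative
        \<Gamma>' $$ (t, j) * (c s0 j $ a * c s0 j $ b)
          + g s0 $$ (t, j) * (U' j $ a * c s0 j $ b + c s0 j $ a * U' j $ b)) (at s0)"
      by (rule derivative_eq_intros dg[OF t j] dc[OF j a] dc[OF j b] refl)+
         (simp add: algebra_simps)
  qed
qed

end

theory Submission
  imports Defs
begin

text \<open>
  Extend the unknowns to all \<open>(U', \<Gamma>')\<close>, tangent or not, and list the tangency conditions among the
  equations. Since the values of \<^const>\<open>J_res\<close> are symmetric, its kernel is then the solution set of
  \<open>m + T * d * (d + 1) / 2\<close> homogeneous linear equations in \<open>m * d + T * m\<close> unknowns, and it is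
  nontrivial whenever there are more unknowns than equations. For the failure of sufficiency take
  \<open>\<Gamma> = 0\<close>, where the tangent directions \<open>U'\<close> are invisible.
\<close>

text \<open>Gaussian elimination, one equation per induction step. An equation whose coefficients
  vanish on \<open>J\<close> is dropped. Otherwise a pivot \<open>k\<close> is solved for and
  eliminated, which costs one equation and one unknown, so the strict inequality of cardinalities
  survives. Arbitrary index types allow sums of products as indices later.\<close>

lemma underdetermined_homogeneous_system:
  fixes A :: "'i \<Rightarrow> 'j \<Rightarrow> 'a :: field"
  assumes "finite I" "finite J" "card I < card J"
  shows "\<exists>x. (\<exists>j\<in>J. x j \<noteq> 0) \<and> (\<forall>i\<in>I. (\<Sum>j\<in>J. A i j * x j) = 0)"
  using assms
proof (induction I arbitrary: J A rule: finite_induct)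
  case empty
  then have "J \<noteq> {}" by auto
  then show ?case by (auto intro!: exI[of _ "\<lambda>_. 1"])
next
  case (insert i I)
  show ?case
  proof (cases "\<forall>j\<in>J. A i j = 0")
    case True
    from insert have "card I < card J" by simp
    from insert.IH[OF \<open>finite J\<close> this, of A] True show ?thesis by auto
  next
    case False
    then obtain k where k: "k \<in> J" "A i k \<noteq> 0" by blast
    from insert k have "card I < card (J - {k})" by (simp add: card_Diff_singleton)
    \<comment> \<open>These are the coefficients that remain after the pivot equation
      \<open>i\<close> is used to substitute for unknown \<open>k\<close> in equation
      \<open>l\<close>.\<close>
    from insert.IH[OF _ this, of "\<lambda>l j. A l j - A l k * A i j / A i k"] \<open>finite J\<close>
    obtain x where x: "\<exists>j\<in>J - {k}. x j \<noteq> 0"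
      and eq: "\<And>l. l \<in> I \<Longrightarrow> (\<Sum>j\<in>J - {k}. (A l j - A l k * A i j / A i k) * x j) = 0"
      by auto
    define s where "s = (\<Sum>j\<in>J - {k}. A i j * x j)"
    \<comment> \<open>Back substitution: the value at \<open>k\<close> is the one that equation
      \<open>i\<close> forces.\<close>
    define y where "y = x(k := - s / A i k)"
    have sum_y: "(\<Sum>j\<in>J. A l j * y j) = (\<Sum>j\<in>J - {k}. A l j * x j) - A l k * s / A i k" for l
    proof -
      have "(\<Sum>j\<in>J - {k}. A l j * y j) = (\<Sum>j\<in>J - {k}. A l j * x j)"
        by (rule sum.cong) (auto simp: y_def)
      then show ?thesis
        using sum.remove[OF \<open>finite J\<close> k(1), of "\<lambda>j. A l j * y j"] by (simp add: y_def)
    qed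
    have "(\<Sum>j\<in>J. A l j * y j) = 0" if "l \<in> insert i I" for l
    proof (cases "l = i")
      case True
      then show ?thesis using k(2) by (simp add: sum_y flip: s_def)
    next
      case False
      then have "0 = (\<Sum>j\<in>J - {k}. A l j * x j - A l k / A i k * (A i j * x j))"
        using that eq[of l] by (simp add: algebra_simps)
      also have "\<dots> = (\<Sum>j\<in>J. A l j * y j)"
        by (simp add: sum_subtractf sum_y s_def sum_distrib_left sum_divide_distrib)
      finally show ?thesis by simp
    qed
    moreover have "\<exists>j\<in>J. y j \<noteq> 0" using x by (auto simp: y_def)
    ultimately show ?thesis by blast
  qed
qed

text \<open>The pairs on or above the diagonal index the independent entries of a symmetric matrix.
  They are counted by columns, and doubling avoids division on \<open>nat\<close>.\<close>

lemma card_upper_triangle: "2 * card {(a, b). a \<le> b \<and> b < d} = d * (d + 1)" for d :: nat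
proof -
  have "{(a, b). a \<le> b \<and> b < d} = (\<lambda>(b, a). (a, b)) ` (SIGMA b:{..<d}. {..b})"
    by auto
  moreover have "inj_on (\<lambda>(b, a). (a, b)) (SIGMA b:{..<d}. {..b})"
    by (auto simp: inj_on_def)
  ultimately have "card {(a, b). a \<le> b \<and> b < d} = (\<Sum>b<d. Suc b)"
    by (simp add: card_image)
  moreover have "2 * (\<Sum>b<d. Suc b) = d * (d + 1)"
    by (induction d) auto
  ultimately show ?thesis by simp
qed

lemma J_res_index:
  assumes "\<And>j. j < m \<Longrightarrow> U j \<in> carrier_vec d" "\<And>j. j < m \<Longrightarrow> U' j \<in> carrier_vec d"
    and "t < T" "a < d" "b < d"
  shows "J_res d m T U \<Gamma> (U', \<Gamma>') t $$ (a, b) =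
    (\<Sum>j<m. \<Gamma>' $$ (t, j) * (U j $ a * U j $ b)
      + \<Gamma> $$ (t, j) * (U' j $ a * U j $ b + U j $ a * U' j $ b))"
proof -
  have "dim_vec (U j) = d" "dim_vec (U' j) = d" if "j < m" for j
    using assms(1,2)[OF that] by auto
  with assms(3-5) show ?thesis by (simp add: J_res_def matsum_def outer_def)
qed

text \<open>Entries suffice without any condition on the arguments: \<open>matsum\<close> fixes the
  format \<open>d\<close> by \<open>d\<close>, and outside \<open>{..<T}\<close> both tuples are
  \<open>undefined\<close>.\<close>

lemma J_res_eqI:
  assumes "\<And>t a b. t < T \<Longrightarrow> a < d \<Longrightarrow> b < d \<Longrightarrow>
    J_res d m T U \<Gamma> p t $$ (a, b) = J_res d m T U \<Gamma> q t $$ (a, b)"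
  shows "J_res d m T U \<Gamma> p = J_res d m T U \<Gamma> q"
proof
  fix t
  show "J_res d m T U \<Gamma> p t = J_res d m T U \<Gamma> q t"
  proof (cases "t < T")
    case True
    show ?thesis
      by (rule eq_matI) (use assms[OF True] True in \<open>auto simp: J_res_def matsum_def split: prod.splits\<close>)
  qed (auto simp: J_res_def split: prod.splits)
qed

text \<open>Counting tangency among the equations avoids choosing bases of the tangent spaces and
  keeps the count free of subtraction.\<close>

lemma J_res_kernel_nontrivial:
  assumes U: "\<And>j. j < m \<Longrightarrow> U j \<in> carrier_vec d"
    and less: "m + T * card {(a, b). a \<le> b \<and> b < d} < m * d + T * m"
  shows "\<not> inj_on (J_res d m T U \<Gamma>) (tangent_perturbations d m T U)"
proof
  assume inj: "inj_on (J_res d m T U \<Gamma>) (tangent_perturbations d m T U)"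
  define E where "E = {(a, b). a \<le> b \<and> b < d}"
  \<comment> \<open>Equations: \<open>Inl k\<close> is tangency at \<open>U k\<close>, and
    \<open>Inr (t, a, b)\<close> is the vanishing of entry \<open>(a, b)\<close> of component
    \<open>t\<close>. Unknowns: \<open>Inl (j, c)\<close> is coordinate \<open>c\<close> of
    \<open>U' j\<close>, and \<open>Inr (s, j)\<close> is entry \<open>(s, j)\<close> of
    \<open>\<Gamma>'\<close>.\<close>
  define I where "I = {..<m} <+> {..<T} \<times> E"
  define J where "J = ({..<m} \<times> {..<d}) <+> ({..<T} \<times> {..<m})"
  \<comment> \<open>The two conditionals on \<open>c\<close> are added rather than nested, because
    both contribute on the diagonal \<open>a = b\<close>.\<close>
  define A where "A i p = (case i of
      Inl k \<Rightarrow> (case p of Inl (j, c) \<Rightarrow> if j = k then U j $ c else 0 | Inr _ \<Rightarrow> 0)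
    | Inr (t, a, b) \<Rightarrow> (case p of
        Inl (j, c) \<Rightarrow> \<Gamma> $$ (t, j) * ((if c = a then U j $ b else 0) + (if c = b then U j $ a else 0))
      | Inr (s, j) \<Rightarrow> if s = t then U j $ a * U j $ b else 0))"
    for i :: "nat + nat \<times> nat \<times> nat" and p :: "nat \<times> nat + nat \<times> nat"
  have fin: "finite E" unfolding E_def
    by (rule finite_subset[of _ "{..<d} \<times> {..<d}"]) auto
  have "card I < card J"
    using less fin by (simp add: I_def J_def E_def card_Plus card_cartesian_product)
  with fin obtain x where x: "\<exists>p\<in>J. x p \<noteq> 0"
    and eq: "\<And>i. i \<in> I \<Longrightarrow> (\<Sum>p\<in>J. A i p * x p) = 0"
    using underdetermined_homogeneous_system[of I J A] by (auto simp: I_def J_def)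
  define U' where "U' = (\<lambda>j\<in>{..<m}. vec d (\<lambda>c. x (Inl (j, c))))"
  define \<Gamma>' where "\<Gamma>' = mat T m (\<lambda>q. x (Inr q))"
  \<comment> \<open>The second double sum is swapped so that \<open>j\<close> is outermost in both;
    they then merge into a single sum over \<open>j\<close>, as in
    \<open>J_res_index\<close>.\<close>
  have sum_J: "(\<Sum>p\<in>J. f p) = (\<Sum>j<m. \<Sum>c<d. f (Inl (j, c))) + (\<Sum>j<m. \<Sum>s<T. f (Inr (s, j)))"
    for f :: "_ \<Rightarrow> real"
    unfolding J_def
    by (simp add: sum.Plus sum.cartesian_product' sum.swap[of _ "{..<m}" "{..<T}"])
  have tangent: "U k \<bullet> U' k = 0" if k: "k < m" for k
  proof -
    have "0 = (\<Sum>j<m. \<Sum>c<d. A (Inl k) (Inl (j, c)) * x (Inl (j, c)))"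
      using eq[of "Inl k"] k by (simp add: sum_J I_def InlI) (simp add: A_def)
    also have "\<dots> = (\<Sum>j<m. if j = k then \<Sum>c<d. U k $ c * x (Inl (k, c)) else 0)"
      by (rule sum.cong) (auto simp: A_def)
    also have "\<dots> = U k \<bullet> U' k"
      using k by (simp add: scalar_prod_def U'_def atLeast0LessThan)
    finally show ?thesis by simp
  qed
  have kernel: "(\<Sum>j<m. \<Gamma>' $$ (t, j) * (U j $ a * U j $ b)
      + \<Gamma> $$ (t, j) * (U' j $ a * U j $ b + U j $ a * U' j $ b)) = 0"
    if t: "t < T" and ab: "a \<le> b" "b < d" for t a b
  proof -
    have "(\<Sum>c<d. A (Inr (t, a, b)) (Inl (j, c)) * x (Inl (j, c)))
        = \<Gamma> $$ (t, j) * (U' j $ a * U j $ b + U j $ a * U' j $ b)" if "j < m" for j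
    proof -
      have "(\<Sum>c<d. A (Inr (t, a, b)) (Inl (j, c)) * x (Inl (j, c)))
        = (\<Sum>c<d. (if c = a then \<Gamma> $$ (t, j) * U j $ b * x (Inl (j, a)) else 0)
             + (if c = b then \<Gamma> $$ (t, j) * U j $ a * x (Inl (j, b)) else 0))"
        by (rule sum.cong) (auto simp: A_def algebra_simps)
      then show ?thesis
        using that ab by (simp add: sum.distrib U'_def algebra_simps)
    qed
    moreover have "(\<Sum>s<T. A (Inr (t, a, b)) (Inr (s, j)) * x (Inr (s, j)))
        = \<Gamma>' $$ (t, j) * (U j $ a * U j $ b)" if "j < m" for j
    proof -
      have "(\<Sum>s<T. A (Inr (t, a, b)) (Inr (s, j)) * x (Inr (s, j)))
        = (\<Sum>s<T. if s = t then U j $ a * U j $ b * x (Inr (t, j)) else 0)"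
        by (rule sum.cong) (auto simp: A_def)
      then show ?thesis
        using that t by (simp add: \<Gamma>'_def)
    qed
    ultimately show ?thesis
      using eq[of "Inr (t, a, b)"] t ab
      by (simp add: I_def E_def InrI sum_J add.commute flip: sum.distrib)
  qed
  have U'_carrier: "U' j \<in> carrier_vec d" if "j < m" for j
    using that by (simp add: U'_def)
  \<comment> \<open>The zero perturbation, restricted to \<open>{..<m}\<close> to be extensional.
    Injectivity is refuted by comparing its image with that of
    \<open>(U', \<Gamma>')\<close>.\<close>
  define O' where "O' = (\<lambda>j\<in>{..<m}. 0\<^sub>v d :: real vec)"
  have O'_carrier: "O' j \<in> carrier_vec d" if "j < m" for j
    using that by (simp add: O'_def)
  have "(U', \<Gamma>') \<in> tangent_perturbations d m T U"
    using tangent U'_carrier by (auto simp: tangent_perturbations_def \<Gamma>'_def U'_def)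
  moreover have "(O', 0\<^sub>m T m) \<in> tangent_perturbations d m T U"
    using U by (auto simp: tangent_perturbations_def O'_def)
  moreover have "J_res d m T U \<Gamma> (U', \<Gamma>') = J_res d m T U \<Gamma> (O', 0\<^sub>m T m)"
  proof (rule J_res_eqI)
    fix t a b assume t: "t < T" and a: "a < d" and b: "b < d"
    \<comment> \<open>Below the diagonal the equation for \<open>(b, a)\<close> is used, since the
      entry formula is symmetric in \<open>a\<close> and \<open>b\<close>.\<close>
    have "J_res d m T U \<Gamma> (U', \<Gamma>') t $$ (a, b) = 0"
      using kernel[OF t, of a b] kernel[OF t, of b a] a b
      by (cases "a \<le> b") (simp_all add: J_res_index U U'_carrier t algebra_simps)
    moreover have "J_res d m T U \<Gamma> (O', 0\<^sub>m T m) t $$ (a, b) = 0"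
      using t a b U O'_carrier by (simp add: J_res_index) (simp add: O'_def)
    ultimately show "J_res d m T U \<Gamma> (U', \<Gamma>') t $$ (a, b)
        = J_res d m T U \<Gamma> (O', 0\<^sub>m T m) t $$ (a, b)" by simp
  qed
  ultimately have "U' = O'" "\<Gamma>' = 0\<^sub>m T m"
    using inj by (auto dest: inj_onD)
  \<comment> \<open>All unknowns can be read back from \<open>U'\<close> and
    \<open>\<Gamma>'\<close>, so \<open>x\<close> would vanish on \<open>J\<close>.\<close>
  have "x (Inl (j, c)) = 0" if "j < m" "c < d" for j c
    using arg_cong[OF \<open>U' = O'\<close>, of "\<lambda>V. V j $ c"] that by (simp add: U'_def O'_def)
  moreover have "x (Inr (t, j)) = 0" if "t < T" "j < m" for t j
    using arg_cong[OF \<open>\<Gamma>' = 0\<^sub>m T m\<close>, of "\<lambda>M. M $$ (t, j)"] that by (simp add: \<Gamma>'_def)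
  ultimately show False
    using x by (auto simp: J_def)
qed

text \<open>The dimension count is compared on \<open>nat\<close> and then cast to the reals, where
  \<open>d - 1\<close> is a genuine subtraction.\<close>

lemma J_res_inj_imp_dimension_le:
  assumes U: "U \<in> {..<m} \<rightarrow>\<^sub>E unit_sphere d"
    and inj: "inj_on (J_res d m T U \<Gamma>) (tangent_perturbations d m T U)"
  shows "real m * (real d - 1) + real T * real m \<le> real T * (real d * (real d + 1) / 2)"
proof -
  define e where "e = card {(a, b). a \<le> b \<and> b < d}"
  have "U j \<in> carrier_vec d" if "j < m" for j
    using U that by (auto simp: unit_sphere_def)
  with inj have "m * d + T * m \<le> m + T * e"
    unfolding e_def using J_res_kernel_nontrivial by (meson not_less)
  then have "real (m * d + T * m) \<le> real (m + T * e)"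
    by (rule of_nat_mono)
  moreover have "real d * (real d + 1) / 2 = real e"
    using arg_cong[OF card_upper_triangle[of d, folded e_def], of real] by (simp add: algebra_simps)
  ultimately show ?thesis by (simp add: algebra_simps)
qed

theorem corollary1:
  shows "(\<forall>d m T :: nat. d \<ge> 1 \<longrightarrow> m \<ge> 1 \<longrightarrow> T \<ge> 1 \<longrightarrow>
      (\<forall>U \<in> {..<m} \<rightarrow>\<^sub>E unit_sphere d. \<forall>\<Gamma> \<in> carrier_mat T m.
        inj_on (J_res d m T U \<Gamma>) (tangent_perturbations d m T U) \<longrightarrow>
        real m * (real d - 1) + real T * real m \<le> real T * (real d * (real d + 1) / 2)))
    \<and> (\<forall>d m T :: nat. d \<ge> 1 \<longrightarrow> m \<ge> 1 \<longrightarrow> T \<ge> 1 \<longrightarrow>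
        real d * (real d + 1) / 2 > real m \<longrightarrow>
        (real m * (real d - 1) + real T * real m \<le> real T * (real d * (real d + 1) / 2) \<longleftrightarrow>
         real T \<ge> real m * (real d - 1) / (real d * (real d + 1) / 2 - real m)))
    \<and> (\<exists>d m T :: nat. d \<ge> 1 \<and> m \<ge> 1 \<and> T \<ge> 1 \<and>
        real d * (real d + 1) / 2 > real m \<and>
        (\<exists>U \<in> {..<m} \<rightarrow>\<^sub>E unit_sphere d. \<exists>\<Gamma> \<in> carrier_mat T m.
          real m * (real d - 1) + real T * real m \<le> real T * (real d * (real d + 1) / 2) \<and>
          \<not> inj_on (J_res d m T U \<Gamma>) (tangent_perturbations d m T U)))"
proof (intro conjI allI impI ballI)
  fix d m T :: nat and U \<Gamma>
  assume "U \<in> {..<m} \<rightarrow>\<^sub>E unit_sphere d"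
    and "inj_on (J_res d m T U \<Gamma>) (tangent_perturbations d m T U)"
  then show "real m * (real d - 1) + real T * real m \<le> real T * (real d * (real d + 1) / 2)"
    by (rule J_res_inj_imp_dimension_le)
next
  fix d m T :: nat
  assume "real d * (real d + 1) / 2 > real m"
  then show "real m * (real d - 1) + real T * real m \<le> real T * (real d * (real d + 1) / 2) \<longleftrightarrow>
      real T \<ge> real m * (real d - 1) / (real d * (real d + 1) / 2 - real m)"
    by (subst pos_divide_le_eq) (auto simp: right_diff_distrib)
next
  \<comment> \<open>Counterexample with \<open>d = 2\<close> and \<open>m = T = 1\<close>, where the
    condition reads 2 \<le> 3. At \<open>\<Gamma> = 0\<close> the tangent vectors
    \<open>unit_vec 2 1\<close> and \<open>0\<^sub>v 2\<close> have the same image.\<close>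
  define U where "U = (\<lambda>j\<in>{..<1::nat}. unit_vec 2 0 :: real vec)"
  define V where "V v = (\<lambda>j\<in>{..<1::nat}. v)" for v :: "real vec"
  define \<Gamma> where "\<Gamma> = (0\<^sub>m 1 1 :: real mat)"
  have U: "U \<in> {..<1} \<rightarrow>\<^sub>E unit_sphere 2"
    by (auto simp: U_def unit_sphere_def L2_set_def numeral_2_eq_2)
  have "\<not> inj_on (J_res 2 1 1 U \<Gamma>) (tangent_perturbations 2 1 1 U)"
  proof
    assume inj: "inj_on (J_res 2 1 1 U \<Gamma>) (tangent_perturbations 2 1 1 U)"
    \<comment> \<open>Being zero, \<open>\<Gamma>\<close> also serves as the perturbation of the
      coefficients.\<close>
    have "(V v, \<Gamma>) \<in> tangent_perturbations 2 1 1 U" if "v \<in> {0\<^sub>v 2, unit_vec 2 1}" for v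
      using that by (auto simp: tangent_perturbations_def U_def V_def \<Gamma>_def)
    moreover have "J_res 2 1 1 U \<Gamma> (V (unit_vec 2 1), \<Gamma>) = J_res 2 1 1 U \<Gamma> (V (0\<^sub>v 2), \<Gamma>)"
      by (rule J_res_eqI) (simp add: J_res_index U_def V_def \<Gamma>_def)
    ultimately have "V (unit_vec 2 1) = V (0\<^sub>v 2)"
      using inj by (auto dest: inj_onD)
    from arg_cong[OF this, of "\<lambda>W. W 0 $ 1"] show False by (simp add: V_def)
  qed
  moreover have "\<Gamma> \<in> carrier_mat 1 1" by (simp add: \<Gamma>_def)
  ultimately show "\<exists>d m T :: nat. d \<ge> 1 \<and> m \<ge> 1 \<and> T \<ge> 1 \<and>
        real d * (real d + 1) / 2 > real m \<and>
        (\<exists>U \<in> {..<m} \<rightarrow>\<^sub>E unit_sphere d. \<exists>\<Gamma> \<in> carrier_mat T m.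
          real m * (real d - 1) + real T * real m \<le> real T * (real d * (real d + 1) / 2) \<and>
          \<not> inj_on (J_res d m T U \<Gamma>) (tangent_perturbations d m T U))"
    using U by (intro exI[of _ 2] exI[of _ 1] conjI bexI[of _ U] bexI[of _ \<Gamma>]) simp_all
qed

end
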